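(* Let $2\le p<\infty$. There exist constants $C_1=C_1(p)>0$, $C_2=C_2(p)>0$ and $L_0=L_0(p)>0$, depending only on $p$, such that for all $0<a<b<\infty$ with $\ln\frac{b}{a}\ge L_0$, $$\left(\frac{p}{p-1}\right)^p-\frac{C_1}{\ln^2\frac{b}{a}}\le d(a,b)\le \left(\frac{p}{p-1}\right)^p-\frac{C_2}{\ln^2\frac{b}{a}}.$$ Moreover, the constant $C_1$ can be taken to satisfy $$C_1\le\left(\frac{p}{p-1}\right)^{p+1}p\pi^2,$$ and for $p=2$ this value is the exact constant, i.e. for $p=2$ one has $\ln^2\frac{b}{a}\,\bigl(4-d(a,b)\bigr)\to 16\pi^2$ as $\ln\frac{b}{a}\to\infty$.
   Context: For $p>1$ and $0<a<b<\infty$, $d(a,b)$ denotes the smallest constant such that the inequality $$\int_a^b\left(\frac{1}{x}\int_a^x f(t)\,dt\right)^p dx\le d(a,b)\int_a^b [f(x)]^p\,dx$$ holds for every $f\in L^p[a,b]$ with $f(x)\ge 0$. *)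

theory Defs
  imports "HOL-Analysis.Analysis"
begin

text \<open>
  Nonnegative elements of \<open>L\<^sup>p[a,b]\<close>, as functions. No absolute value is needed under
  \<open>powr\<close> because of nonnegativity; note \<open>0 powr p = 0\<close>.
\<close>

definition nonneg_Lp :: "real \<Rightarrow> real \<Rightarrow> real \<Rightarrow> (real \<Rightarrow> real) set" where
  "nonneg_Lp p a b = {f. set_borel_measurable lebesgue {a..b} f
     \<and> set_integrable lebesgue {a..b} (\<lambda>x. f x powr p)
     \<and> (\<forall>x\<in>{a..b}. 0 \<le> f x)}"

definition hardy_bound :: "real \<Rightarrow> real \<Rightarrow> real \<Rightarrow> real \<Rightarrow> bool" where
  "hardy_bound p a b C \<longleftrightarrow> (\<forall>f\<in>nonneg_Lp p a b.
     (LINT x:{a..b}|lebesgue. (1 / x * (LINT t:{a..x}|lebesgue. f t)) powr p)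
       \<le> C * (LINT x:{a..b}|lebesgue. f x powr p))"

text \<open>
  The constant \<open>d(a,b)\<close>. For \<open>p > 1\<close> and \<open>0 < a < b\<close> the minimum exists: the admissible
  constants form a closed set, bounded below by \<open>0\<close> (take \<open>f = 1\<close>) and nonempty by Hardy's
  inequality. All integrals in \<open>hardy_bound\<close> then exist, since \<open>L\<^sup>p[a,b] \<subseteq> L\<^sup>1[a,b]\<close> and the
  averaged function is bounded on \<open>[a,b]\<close>.
\<close>

definition hardy_const :: "real \<Rightarrow> real \<Rightarrow> real \<Rightarrow> real" where
  "hardy_const p a b = (LEAST C. hardy_bound p a b C)"

end

theory Submission
  imports Defs
begin

text \<open>
  Write \<open>e = 1 - 1/p\<close>, so that \<open>p/(p-1) = 1/e\<close>, and \<open>L = ln (b/a)\<close>. In the variable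
  \<open>s = ln (x/a)\<close>, a primitive \<open>F x = x\<^sup>e * g s\<close> turns the two integrals of Hardy's inequality into
  the integrals of \<open>g\<^sup>p\<close> and of \<open>(e * g + g')\<^sup>p\<close> over \<open>[0,L]\<close>. A constant \<open>g\<close> would give the
  ratio \<open>e\<^sup>-\<^sup>p\<close>, the classical Hardy constant, but \<open>g 0 = 0\<close> forces an oscillation of frequency
  about \<open>pi/L\<close>, and this costs an amount of order \<open>1/L\<^sup>2\<close>.

  Lower bound. The test function is \<open>g s = sin (\<alpha> * s)\<close>. Then \<open>e * g + g'\<close> is the phase-shifted
  sine \<open>R * sin (\<alpha> * s + \<phi>)\<close> with \<open>R\<^sup>2 = e\<^sup>2 + \<alpha>\<^sup>2\<close> and \<open>\<phi> = arctan (\<alpha>/e)\<close>. If \<open>\<alpha>\<close> is chosen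
  with \<open>\<alpha> * L + \<phi> = pi\<close>, this function is nonnegative on \<open>[0,L]\<close>, and the reflection
  \<open>s \<mapsto> L - s\<close> exchanges \<open>sin (\<alpha> * s)\<close> and \<open>sin (\<alpha> * s + \<phi>)\<close>. So the ratio of the integrals is
  exactly \<open>R\<^sup>-\<^sup>p\<close>, whatever \<open>p\<close> is (\<open>hardy_bound_ge_sine\<close>). As \<open>\<alpha> < pi/L\<close>, Bernoulli's inequality
  gives the stated \<open>C\<^sub>1\<close>.

  Upper bound. This is a Schur test (\<open>hardy_bound_schur_test\<close>): for a positive weight \<open>k\<close> with
  primitive \<open>K\<close>, Hoelder's inequality gives
  \<open>(\<integral>\<^sub>a\<^sup>x f)\<^sup>p \<le> K x\<^sup>p\<^sup>-\<^sup>1 * \<integral>\<^sub>a\<^sup>x f\<^sup>p * k\<^sup>1\<^sup>-\<^sup>p\<close>, and after an exchange of the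
  integrations it is enough that \<open>\<integral>\<^sub>t\<^sup>b K x\<^sup>p\<^sup>-\<^sup>1 * x\<^sup>-\<^sup>p dx \<le> D * k t\<^sup>p\<^sup>-\<^sup>1\<close>. For \<open>K x = x\<^sup>e * g s\<close>
  this is a first-order differential inequality for \<open>u = e + g'/g\<close>, and a \<open>u\<close> that decreases
  linearly across \<open>e\<close> by an amount of order \<open>1/L\<close> satisfies it with \<open>D = e\<^sup>-\<^sup>p / (1 + 1/(12 L\<^sup>2))\<close>
  (\<open>hardy_bound_linear_profile\<close>).

  For \<open>p = 2\<close> the sine itself is admissible in the Schur test, since there
  \<open>K x = sqrt x * sin (\<alpha> * s)\<close> solves the linear equation \<open>- K'' = (1/4 + \<alpha>\<^sup>2) * K / x\<^sup>2\<close> with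
  \<open>K' b = 0\<close>. Both bounds then meet: \<open>d(a,b) = 4 / (1 + 4 \<alpha>\<^sup>2)\<close> (\<open>hardy_const_two\<close>). Since
  \<open>\<alpha> * L = pi - arctan (2 \<alpha>)\<close> tends to \<open>pi\<close>, the limit follows.
\<close>

section \<open>A weighted Hoelder inequality\<close>

lemma bernoulli_powr:
  fixes r y :: real
  assumes "1 \<le> r" "-1 \<le> y"
  shows "1 + r * y \<le> (1 + y) powr r"
proof (cases "y = -1")
  case True
  then show ?thesis using assms by simp
next
  case False
  then have y: "0 < 1 + y" using assms by simp
  have "((1 + y) powr r) powr (1 / r) * 1 powr (1 - 1 / r)
      \<le> (1 / r) * (1 + y) powr r + (1 - 1 / r) * 1"
    by (rule Youngs_inequality_0) (use assms y in auto)
  then have "1 + y \<le> (1 / r) * (1 + y) powr r + (1 - 1 / r)"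
    using assms y by (simp add: powr_powr)
  then have "r * (1 + y) \<le> r * ((1 / r) * (1 + y) powr r + (1 - 1 / r))"
    using assms by (intro mult_left_mono) auto
  moreover have "r * ((1 / r) * (1 + y) powr r + (1 - 1 / r)) = (1 + y) powr r + r - 1"
    using assms by (simp add: right_diff_distrib distrib_left)
  ultimately show ?thesis
    by (simp add: distrib_left)
qed

text \<open>
  The graph of \<open>r \<mapsto> r\<^sup>p\<close> lies above its tangent at \<open>s\<close>. Solved for \<open>r\<close>, this is
  Young's inequality with a free parameter \<open>s\<close>, linear in \<open>r\<^sup>p\<close> and therefore ready to be integrated.
\<close>

lemma powr_above_tangent:
  fixes p r s :: real
  assumes "1 < p" "0 \<le> r" "0 < s"
  shows "r \<le> (1 - 1 / p) * s + 1 / p * (s powr (1 - p) * r powr p)"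
proof -
  have "1 + p * (r / s - 1) \<le> (1 + (r / s - 1)) powr p"
    using assms by (intro bernoulli_powr) auto
  also have "\<dots> = r powr p / s powr p"
    using assms by (simp add: powr_divide)
  finally have "s * (1 + p * (r / s - 1)) \<le> s * (r powr p / s powr p)"
    using assms by (intro mult_left_mono) auto
  also have "\<dots> = s powr (1 - p) * r powr p"
    using assms by (simp add: powr_diff)
  finally have "1 / p * (s * (1 + p * (r / s - 1))) \<le> 1 / p * (s powr (1 - p) * r powr p)"
    using assms by (intro mult_left_mono) auto
  moreover have "1 / p * (s * (1 + p * (r / s - 1))) = r - (1 - 1 / p) * s"
    using assms by (simp add: field_simps)
  ultimately show ?thesis by linarith
qed

text \<open>
  Hoelder's inequality for \<open>f = (f * k\<^sup>-\<^sup>1\<^sup>/\<^sup>q) * k\<^sup>1\<^sup>/\<^sup>q\<close>, \<open>q\<close> the conjugate exponent. The right-hand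
  side is an extended nonnegative integral, so that nothing has to be known about the convergence of
  \<open>\<integral> f\<^sup>p * k\<^sup>1\<^sup>-\<^sup>p\<close>. The proof integrates the tangent inequality at the point \<open>s * k t\<close>, where
  \<open>s = (\<integral> f) / V\<close> is the mean value of \<open>f\<close> for the weight \<open>k\<close> if \<open>V\<close> is the integral of \<open>k\<close>; an
  upper bound \<open>V\<close> of that integral does as well.
\<close>

lemma weighted_holder_ennreal:
  fixes f k :: "real \<Rightarrow> real" and a x p V V0 :: real
  assumes p: "1 < p"
    and f: "set_borel_measurable lebesgue {a..x} f" "\<And>t. t \<in> {a..x} \<Longrightarrow> 0 \<le> f t"
    and k: "\<And>t. t \<in> {a..x} \<Longrightarrow> 0 < k t" "(k has_integral V0) {a..x}"
    and V: "V0 \<le> V" "a \<le> x" "a < x \<Longrightarrow> 0 < V"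
  shows "ennreal ((LINT t:{a..x}|lebesgue. f t) powr p)
     \<le> ennreal (V powr (p - 1)) *
        (\<integral>\<^sup>+t. ennreal (indicator {a..x} t * (f t powr p * k t powr (1 - p))) \<partial>lebesgue)"
    (is "ennreal (?F powr p) \<le> _ * ?A")
proof (cases "0 < ?F")
  case False
  moreover have "0 \<le> ?F"
    unfolding set_lebesgue_integral_def
    by (intro integral_nonneg_AE) (auto simp: indicator_def f)
  ultimately have "?F = 0" by linarith
  then show ?thesis by simp
next
  case True
  have int: "integrable lebesgue (\<lambda>t. indicator {a..x} t *\<^sub>R f t)"
    using True not_integrable_integral_eq unfolding set_lebesgue_integral_def by fastforce
  have "x \<noteq> a"
  proof
    assume "x = a"
    have "AE t in lebesgue. t \<noteq> a"
      by (intro AE_completion AE_lborel_singleton)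
    then have "AE t in lebesgue. indicator {a..x} t *\<^sub>R f t = 0"
      by (rule eventually_mono) (simp add: \<open>x = a\<close>)
    then have "?F = 0"
      unfolding set_lebesgue_integral_def by (rule integral_eq_zero_AE)
    with True show False by simp
  qed
  with V have V_pos: "0 < V" by simp
  define s where "s = ?F / V"
  have s: "0 < s" using True V_pos by (simp add: s_def)
  have k_meas [measurable]: "(\<lambda>t. indicator {a..x} t * k t) \<in> borel_measurable lebesgue"
    using has_integral_implies_lebesgue_measurable[OF k(2)] by simp
  have f_meas [measurable]: "(\<lambda>t. indicator {a..x} t * f t) \<in> borel_measurable lebesgue"
    using f(1) by (simp add: set_borel_measurable_def)
  have "(\<lambda>t. (indicator {a..x} t * f t) powr p * (indicator {a..x} t * k t) powr (1 - p))
      \<in> borel_measurable lebesgue"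
    by (intro borel_measurable_times powr_real_measurable k_meas f_meas) auto
  moreover have "(\<lambda>t. (indicator {a..x} t * f t) powr p * (indicator {a..x} t * k t) powr (1 - p))
      = (\<lambda>t. indicator {a..x} t * (f t powr p * k t powr (1 - p)))"
    by (auto simp: indicator_def)
  ultimately have [measurable]:
    "(\<lambda>t. indicator {a..x} t * (f t powr p * k t powr (1 - p))) \<in> borel_measurable lebesgue"
    by simp
  have intk: "(\<integral>\<^sup>+t. ennreal (indicator {a..x} t * k t) \<partial>lebesgue) \<le> ennreal V"
  proof -
    have "(\<integral>\<^sup>+t. ennreal (indicator {a..x} t * k t) \<partial>lebesgue) = ennreal V0"
      using nn_integral_has_integral_lebesgue[OF _ k(2)] k(1)
      by (simp add: nn_integral_completion less_imp_le)
    with V show ?thesis by (simp add: ennreal_leI)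
  qed
  have "ennreal ?F = (\<integral>\<^sup>+t. ennreal (indicator {a..x} t *\<^sub>R f t) \<partial>lebesgue)"
    unfolding set_lebesgue_integral_def using f(2)
    by (intro nn_integral_eq_integral[OF int, symmetric]) (auto simp: indicator_def)
  also have "\<dots> \<le> (\<integral>\<^sup>+t. ennreal ((1 - 1 / p) * s) * ennreal (indicator {a..x} t * k t)
      + ennreal (1 / p * s powr (1 - p))
         * ennreal (indicator {a..x} t * (f t powr p * k t powr (1 - p))) \<partial>lebesgue)"
  proof (rule nn_integral_mono)
    fix t
    show "ennreal (indicator {a..x} t *\<^sub>R f t) \<le> ennreal ((1 - 1 / p) * s) * ennreal (indicator {a..x} t * k t)
      + ennreal (1 / p * s powr (1 - p))
         * ennreal (indicator {a..x} t * (f t powr p * k t powr (1 - p)))"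
    proof (cases "t \<in> {a..x}")
      case True
      have "f t \<le> (1 - 1 / p) * (s * k t) + 1 / p * ((s * k t) powr (1 - p) * f t powr p)"
        using p True f(2) k(1) s by (intro powr_above_tangent) auto
      also have "\<dots> = (1 - 1 / p) * s * k t
          + 1 / p * s powr (1 - p) * (f t powr p * k t powr (1 - p))"
        using s True k(1)[of t] by (simp add: powr_mult)
      finally have "f t \<le> \<dots>" .
      then show ?thesis
        using True p s k(1)[of t]
        by (simp flip: ennreal_mult ennreal_plus add: ennreal_leI)
    qed simp
  qed
  also have "\<dots> = ennreal ((1 - 1 / p) * s) * (\<integral>\<^sup>+t. ennreal (indicator {a..x} t * k t) \<partial>lebesgue)
      + ennreal (1 / p * s powr (1 - p)) * ?A"
    by (simp add: nn_integral_add nn_integral_cmult)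
  also have "\<dots> \<le> ennreal ((1 - 1 / p) * s) * ennreal V + ennreal (1 / p * s powr (1 - p)) * ?A"
    by (intro add_right_mono mult_left_mono intk) simp
  finally have main: "ennreal ?F
      \<le> ennreal ((1 - 1 / p) * s) * ennreal V + ennreal (1 / p * s powr (1 - p)) * ?A" .
  show ?thesis
  proof (cases ?A)
    case (real A)
    have "ennreal ((1 - 1 / p) * s) * ennreal V = ennreal ((1 - 1 / p) * ?F)"
    proof -
      have "ennreal ((1 - 1 / p) * s) * ennreal V = ennreal ((1 - 1 / p) * s * V)"
        using p s V_pos by (intro ennreal_mult[symmetric]) auto
      also have "(1 - 1 / p) * s * V = (1 - 1 / p) * ?F"
        using V_pos by (simp add: s_def)
      finally show ?thesis .
    qed
    with main real p s True have "ennreal ?F \<le> ennreal ((1 - 1 / p) * ?F + 1 / p * s powr (1 - p) * A)"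
      by (simp flip: ennreal_mult ennreal_plus)
    then have "?F \<le> (1 - 1 / p) * ?F + 1 / p * s powr (1 - p) * A"
      by (rule iffD1[OF ennreal_le_iff, rotated])
        (use p True real in \<open>intro add_nonneg_nonneg mult_nonneg_nonneg; simp\<close>)
    then have "?F \<le> s powr (1 - p) * A"
      using p by (simp add: field_simps)
    then have "?F powr (p - 1) * ?F \<le> ?F powr (p - 1) * (s powr (1 - p) * A)"
      by (intro mult_left_mono) auto
    also have "s powr (1 - p) = ?F powr (1 - p) * V powr (p - 1)"
      using powr_minus_divide[of V "1 - p"] True V_pos by (simp add: s_def powr_divide)
    also have "?F powr (p - 1) * (?F powr (1 - p) * V powr (p - 1) * A) = V powr (p - 1) * A"
      using True by (simp flip: powr_add mult.assoc)
    also have "?F powr (p - 1) * ?F = ?F powr p"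
      using True by (simp add: powr_diff)
    finally show ?thesis using real by (simp flip: ennreal_mult add: ennreal_leI)
  next
    case top
    then show ?thesis using V_pos by (simp add: ennreal_mult_top)
  qed
qed

section \<open>The Schur test\<close>

lemma sigma_finite_lebesgue: "sigma_finite_measure (lebesgue :: 'a :: euclidean_space measure)"
proof
  obtain A :: "'a set set" where "countable A" "A \<subseteq> sets lborel" "\<Union>A = space lborel"
    "\<forall>a\<in>A. emeasure lborel a \<noteq> \<infinity>"
    using lborel.sigma_finite_countable by auto
  then show "\<exists>A :: 'a set set. countable A \<and> A \<subseteq> sets lebesgue \<and> \<Union>A = space lebesgue
      \<and> (\<forall>a\<in>A. emeasure lebesgue a \<noteq> \<infinity>)"
    by (intro exI[of _ A]) auto
qed

text \<open>
  The Schur test. The function \<open>H\<close> stands for a majorant of \<open>\<integral>\<^sub>t\<^sup>b K x\<^sup>p\<^sup>-\<^sup>1 * x\<^sup>-\<^sup>p dx\<close>; asking only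
  for a differential inequality and the sign at \<open>b\<close> avoids computing that integral. The weight may
  vanish at \<open>b\<close>, as the extremal weight for \<open>p = 2\<close> does, and \<open>K\<close> may be any primitive that is
  nonnegative at \<open>a\<close>, which allows profiles that do not vanish there.
\<close>

lemma hardy_bound_schur_test:
  fixes p a b D :: real and K k H H' :: "real \<Rightarrow> real"
  assumes p: "1 < p" and ab: "0 < a" "a < b" and D: "0 \<le> D"
    and K: "\<And>x. x \<in> {a..b} \<Longrightarrow> (K has_real_derivative k x) (at x)" "0 \<le> K a"
    and k: "continuous_on {a..b} k" "\<And>x. x \<in> {a..<b} \<Longrightarrow> 0 < k x"
    and H: "\<And>x. x \<in> {a..b} \<Longrightarrow> (H has_real_derivative H' x) (at x)" "0 \<le> H b"
    and H_decay: "\<And>x. x \<in> {a..b} \<Longrightarrow> K x powr (p - 1) * x powr (- p) \<le> - H' x"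
    and H_le: "\<And>x. x \<in> {a..<b} \<Longrightarrow> H x \<le> D * k x powr (p - 1)"
  shows "hardy_bound p a b D"
  unfolding hardy_bound_def
proof
  fix f assume "f \<in> nonneg_Lp p a b"
  then have f_meas: "set_borel_measurable lebesgue {a..b} f"
    and f_int: "set_integrable lebesgue {a..b} (\<lambda>x. f x powr p)"
    and f_nonneg: "\<And>x. x \<in> {a..b} \<Longrightarrow> 0 \<le> f x"
    by (auto simp: nonneg_Lp_def)
  define F where "F x = (LINT t:{a..x}|lebesgue. f t)" for x
  define M where "M x = K x powr (p - 1) * x powr (- p)" for x
  define E where "E t = indicator {a..<b} t * (f t powr p * k t powr (1 - p))" for t
  interpret L: sigma_finite_measure "lebesgue :: real measure"
    by (rule sigma_finite_lebesgue)
  interpret LL: pair_sigma_finite "lebesgue :: real measure" "lebesgue :: real measure" ..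

  have cont_K: "continuous_on {a..b} K"
    using K(1) by (meson DERIV_isCont continuous_at_imp_continuous_on)
  have K_less: "K a < K x" if "a < x" "x \<le> b" for x
  proof (rule DERIV_pos_imp_increasing_open[OF that(1)])
    show "\<exists>y. (K has_real_derivative y) (at t) \<and> 0 < y" if "a < t" "t < x" for t
      using K(1)[of t] k(2)[of t] that \<open>x \<le> b\<close> by auto
    show "continuous_on {a..x} K"
      by (rule continuous_on_subset[OF cont_K]) (use that in auto)
  qed
  have K_nonneg: "0 \<le> K x" if "x \<in> {a..b}" for x
    using K_less[of x] K(2) that by (cases "x = a") auto
  have K_int: "(k has_integral (K x - K a)) {a..x}" if "x \<in> {a..<b}" for x
    using that K(1)
    by (intro fundamental_theorem_of_calculus)
       (auto simp flip: has_real_derivative_iff_has_vector_derivative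
             intro: has_field_derivative_at_within)
  have M_int: "(\<integral>\<^sup>+x. ennreal (indicator {t..b} x * M x) \<partial>lebesgue) \<le> ennreal (H t)"
    if t: "t \<in> {a..<b}" for t
  proof -
    have "continuous_on {t..b} M"
      unfolding M_def using t ab p K_nonneg
      by (intro continuous_intros continuous_on_powr' continuous_on_subset[OF cont_K]) auto
    then have M_has: "(M has_integral integral {t..b} M) {t..b}"
      by (intro integrable_integral integrable_continuous_real)
    moreover have "((\<lambda>x. - H' x) has_integral (- H b - (- H t))) {t..b}"
    proof (rule fundamental_theorem_of_calculus)
      fix x assume "x \<in> {t..b}"
      with t have "((\<lambda>x. - H x) has_real_derivative - H' x) (at x within {t..b})"
        by (intro DERIV_minus has_field_derivative_at_within[OF H(1)]) auto
      then show "((\<lambda>x. - H x) has_vector_derivative - H' x) (at x within {t..b})"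
        by (simp add: has_real_derivative_iff_has_vector_derivative)
    qed (use t in auto)
    ultimately have "integral {t..b} M \<le> - H b - (- H t)"
      by (rule has_integral_le) (use t H_decay in \<open>auto simp: M_def\<close>)
    moreover have "(\<integral>\<^sup>+x. ennreal (indicator {t..b} x * M x) \<partial>lebesgue) = ennreal (integral {t..b} M)"
      using nn_integral_has_integral_lebesgue[OF _ M_has]
      by (simp add: nn_integral_completion M_def)
    ultimately show ?thesis using H(2) by (simp add: ennreal_leI)
  qed

  have k_meas: "(\<lambda>t. indicator {a..<b} t * k t) \<in> borel_measurable lebesgue"
  proof -
    have "(\<lambda>t. indicator {a..<b} t *\<^sub>R k t) \<in> borel_measurable borel"
      by (intro borel_measurable_continuous_on_indicator continuous_on_subset[OF k(1)]) auto
    then show ?thesis by (simp add: measurable_completion)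
  qed
  have f_meas': "(\<lambda>t. indicator {a..<b} t * f t) \<in> borel_measurable lebesgue"
  proof -
    have "(\<lambda>t. indicator {a..<b} t * (indicator {a..b} t *\<^sub>R f t)) \<in> borel_measurable lebesgue"
      using f_meas unfolding set_borel_measurable_def
      by (intro borel_measurable_times borel_measurable_indicator sets_completionI_sets) auto
    then show ?thesis by (rule back_subst[of "\<lambda>g. g \<in> _"]) (auto simp: indicator_def)
  qed
  have E_meas [measurable]: "E \<in> borel_measurable lebesgue"
  proof -
    have "(\<lambda>t. (indicator {a..<b} t * f t) powr p * (indicator {a..<b} t * k t) powr (1 - p))
        \<in> borel_measurable lebesgue"
      by (intro borel_measurable_times powr_real_measurable k_meas f_meas') auto
    then show ?thesis by (rule back_subst[of "\<lambda>g. g \<in> _"]) (auto simp: indicator_def E_def)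
  qed
  have M_meas: "(\<lambda>x. indicator S x * M x) \<in> borel_measurable lebesgue"
    if "S \<subseteq> {a..b}" "S \<in> sets borel" for S
  proof -
    have "continuous_on S M"
      unfolding M_def using that ab p K_nonneg
      by (intro continuous_intros continuous_on_powr' continuous_on_subset[OF cont_K]) auto
    then have "(\<lambda>t. indicator S t *\<^sub>R M t) \<in> borel_measurable borel"
      by (intro borel_measurable_continuous_on_indicator that)
    then show ?thesis by (simp add: measurable_completion)
  qed
  note [measurable] = M_meas[of "{a..<b}", simplified]

  \<comment> \<open>Hoelder's inequality, with the upper limit \<open>x\<close> kept away from \<open>b\<close>, where \<open>k\<close> may vanish.\<close>
  have pointwise: "ennreal ((1 / x * F x) powr p)
      \<le> ennreal (indicator {a..<b} x * M x) * (\<integral>\<^sup>+t. ennreal (indicator {a..x} t * E t) \<partial>lebesgue)"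
    if x: "x \<in> {a..<b}" for x
  proof -
    have "ennreal (F x powr p) \<le> ennreal (K x powr (p - 1)) *
        (\<integral>\<^sup>+t. ennreal (indicator {a..x} t * (f t powr p * k t powr (1 - p))) \<partial>lebesgue)"
      unfolding F_def
    proof (rule weighted_holder_ennreal)
      show "set_borel_measurable lebesgue {a..x} f"
        by (rule set_borel_measurable_subset[OF f_meas]) (use x in auto)
      show "0 < K x" if "a < x" using K_less[OF that] x K(2) by auto
    qed (use p x f_nonneg k(2) K_int[OF x] K(2) in auto)
    also have "(\<integral>\<^sup>+t. ennreal (indicator {a..x} t * (f t powr p * k t powr (1 - p))) \<partial>lebesgue)
        = (\<integral>\<^sup>+t. ennreal (indicator {a..x} t * E t) \<partial>lebesgue)"
      using x by (intro nn_integral_cong) (auto simp: E_def indicator_def)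
    finally have "ennreal (x powr (- p)) * ennreal (F x powr p)
        \<le> ennreal (x powr (- p)) * (ennreal (K x powr (p - 1))
           * (\<integral>\<^sup>+t. ennreal (indicator {a..x} t * E t) \<partial>lebesgue))"
      by (rule mult_left_mono) simp
    moreover have "0 \<le> F x"
      unfolding F_def set_lebesgue_integral_def
      by (intro integral_nonneg_AE) (use x f_nonneg in \<open>auto simp: indicator_def\<close>)
    then have "(1 / x * F x) powr p = x powr (- p) * F x powr p"
      using x ab by (simp add: powr_divide powr_minus_divide)
    then have "ennreal ((1 / x * F x) powr p) = ennreal (x powr (- p)) * ennreal (F x powr p)"
      by (simp add: ennreal_mult)
    moreover have "ennreal (indicator {a..<b} x * M x)
        = ennreal (x powr (- p)) * ennreal (K x powr (p - 1))"
      using x by (simp add: M_def ennreal_mult mult.commute)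
    ultimately show ?thesis by (simp add: mult.assoc)
  qed

  have E_H: "ennreal (E t) * ennreal (H t) \<le> ennreal (D * (indicator {a..b} t * f t powr p))" for t
  proof (cases "t \<in> {a..<b}")
    case True
    have "ennreal (E t) * ennreal (H t) \<le> ennreal (E t) * ennreal (D * k t powr (p - 1))"
      using H_le[OF True] by (intro mult_left_mono ennreal_leI) auto
    also have "\<dots> = ennreal (E t * (D * k t powr (p - 1)))"
      using D by (simp add: E_def ennreal_mult)
    also have "E t * (D * k t powr (p - 1)) = D * (f t powr p * (k t powr (1 - p) * k t powr (p - 1)))"
      using True by (simp add: E_def mult_ac)
    also have "k t powr (1 - p) * k t powr (p - 1) = 1"
      using k(2)[OF True] by (simp flip: powr_add)
    finally show ?thesis using True by simp
  qed (simp add: E_def)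

  have upper: "(\<integral>\<^sup>+x. ennreal (indicator {a..b} x * (1 / x * F x) powr p) \<partial>lebesgue)
      \<le> ennreal (D * (LINT x:{a..b}|lebesgue. f x powr p))"
  proof -
    have "AE x in lebesgue. x \<noteq> b"
      by (intro AE_completion AE_lborel_singleton)
    then have "(\<integral>\<^sup>+x. ennreal (indicator {a..b} x * (1 / x * F x) powr p) \<partial>lebesgue)
        \<le> (\<integral>\<^sup>+x. ennreal (indicator {a..<b} x * M x)
            * (\<integral>\<^sup>+t. ennreal (indicator {a..x} t * E t) \<partial>lebesgue) \<partial>lebesgue)"
      by (intro nn_integral_mono_AE, elim eventually_mono) (use pointwise in \<open>auto split: split_indicator\<close>)
    also have "\<dots> = (\<integral>\<^sup>+x. (\<integral>\<^sup>+t. ennreal (indicator {a..<b} x * M x) * (if t \<le> x then 1 else 0)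
        * ennreal (E t) \<partial>lebesgue) \<partial>lebesgue)"
    proof (rule nn_integral_cong)
      fix x :: real
      have "ennreal (indicator {a..<b} x * M x) * (\<integral>\<^sup>+t. ennreal (indicator {a..x} t * E t) \<partial>lebesgue)
         = (\<integral>\<^sup>+t. ennreal (indicator {a..<b} x * M x) * ennreal (indicator {a..x} t * E t) \<partial>lebesgue)"
        by (intro nn_integral_cmult[symmetric] measurable_compose[OF _ measurable_ennreal]
              borel_measurable_times borel_measurable_indicator sets_completionI_sets E_meas) auto
      also have "\<dots> = (\<integral>\<^sup>+t. ennreal (indicator {a..<b} x * M x) * (if t \<le> x then 1 else 0)
        * ennreal (E t) \<partial>lebesgue)"
        by (intro nn_integral_cong) (auto simp: E_def indicator_def)
      finally show "ennreal (indicator {a..<b} x * M x) * (\<integral>\<^sup>+t. ennreal (indicator {a..x} t * E t) \<partial>lebesgue)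
         = \<dots>" .
    qed
    also have "\<dots> = (\<integral>\<^sup>+t. (\<integral>\<^sup>+x. ennreal (indicator {a..<b} x * M x) * (if t \<le> x then 1 else 0)
        * ennreal (E t) \<partial>lebesgue) \<partial>lebesgue)"
    proof (rule LL.Fubini')
      let ?N = "lebesgue \<Otimes>\<^sub>M lebesgue :: (real \<times> real) measure"
      have id: "(\<lambda>x :: real. x) \<in> borel_measurable lebesgue"
        by (simp add: measurable_completion)
      have "{z \<in> space ?N. fst z \<le> snd z} \<in> sets ?N"
        by (intro borel_measurable_le measurable_compose[OF measurable_fst id]
            measurable_compose[OF measurable_snd id])
      then have "(\<lambda>z. if fst z \<le> snd z then 1 else 0 :: ennreal) \<in> borel_measurable ?N"
        by (intro measurable_If) auto
      moreover have "(\<lambda>z. ennreal (indicator {a..<b} (snd z) * M (snd z))) \<in> borel_measurable ?N"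
        by (rule measurable_compose[OF measurable_snd measurable_compose[OF M_meas measurable_ennreal]]) auto
      moreover have "(\<lambda>z. ennreal (E (fst z))) \<in> borel_measurable ?N"
        by (rule measurable_compose[OF measurable_fst measurable_compose[OF E_meas measurable_ennreal]])
      ultimately show "(\<lambda>(t, x). ennreal (indicator {a..<b} x * M x) * (if t \<le> x then 1 else 0) * ennreal (E t))
          \<in> borel_measurable ?N"
        unfolding case_prod_beta by (intro borel_measurable_times_ennreal)
    qed
    also have "\<dots> \<le> (\<integral>\<^sup>+t. ennreal (D * (indicator {a..b} t * f t powr p)) \<partial>lebesgue)"
    proof (rule nn_integral_mono)
      fix t :: real
      show "(\<integral>\<^sup>+x. ennreal (indicator {a..<b} x * M x) * (if t \<le> x then 1 else 0)
          * ennreal (E t) \<partial>lebesgue) \<le> ennreal (D * (indicator {a..b} t * f t powr p))"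
      proof (cases "t \<in> {a..<b}")
        case True
        have "(\<integral>\<^sup>+x. ennreal (indicator {a..<b} x * M x) * (if t \<le> x then 1 else 0)
          * ennreal (E t) \<partial>lebesgue) \<le> (\<integral>\<^sup>+x. ennreal (E t) * ennreal (indicator {t..b} x * M x) \<partial>lebesgue)"
          using True by (intro nn_integral_mono) (auto simp: indicator_def mult.commute)
        also have "\<dots> = ennreal (E t) * (\<integral>\<^sup>+x. ennreal (indicator {t..b} x * M x) \<partial>lebesgue)"
          using True M_meas[of "{t..b}"] by (intro nn_integral_cmult) auto
        also have "\<dots> \<le> ennreal (E t) * ennreal (H t)"
          by (intro mult_left_mono M_int True) simp
        also note E_H
        finally show ?thesis .
      qed (simp add: E_def)
    qed
    also have "\<dots> = ennreal (D * (LINT x:{a..b}|lebesgue. f x powr p))"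
      using f_int D unfolding set_integrable_def set_lebesgue_integral_def
      by (subst nn_integral_eq_integral) auto
    finally show ?thesis .
  qed
  have N_nonneg: "0 \<le> (LINT x:{a..b}|lebesgue. f x powr p)"
    unfolding set_lebesgue_integral_def by (intro integral_nonneg_AE) auto
  show "(LINT x:{a..b}|lebesgue. (1 / x * (LINT t:{a..x}|lebesgue. f t)) powr p)
       \<le> D * (LINT x:{a..b}|lebesgue. f x powr p)"
  \<comment> \<open>A function that is not integrable has Bochner integral \<open>0\<close>, and then the bound is trivial.\<close>
  proof (cases "set_integrable lebesgue {a..b} (\<lambda>x. (1 / x * F x) powr p)")
    case True
    then have "ennreal (LINT x:{a..b}|lebesgue. (1 / x * F x) powr p)
        = (\<integral>\<^sup>+x. ennreal (indicator {a..b} x * (1 / x * F x) powr p) \<partial>lebesgue)"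
      unfolding set_integrable_def set_lebesgue_integral_def
      by (subst nn_integral_eq_integral) auto
    also note upper
    finally have "(LINT x:{a..b}|lebesgue. (1 / x * F x) powr p)
        \<le> D * (LINT x:{a..b}|lebesgue. f x powr p)"
      using N_nonneg D by (subst (asm) ennreal_le_iff) auto
    then show ?thesis by (simp add: F_def)
  next
    case False
    then have "(LINT x:{a..b}|lebesgue. (1 / x * F x) powr p) = 0"
      unfolding set_integrable_def set_lebesgue_integral_def by (rule not_integrable_integral_eq)
    then show ?thesis using N_nonneg D by (simp add: F_def)
  qed
qed

section \<open>Functions of the logarithm\<close>

text \<open>
  The logarithmic substitution: all weights and test functions below have the form
  \<open>x\<^sup>e * g (ln (x/a))\<close>, and differentiation keeps this form, replacing \<open>e\<close> by \<open>e - 1\<close> and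
  \<open>g\<close> by \<open>e * g + g'\<close>.
\<close>

lemma DERIV_powr_times_comp_ln:
  fixes e a x :: real
  assumes x: "0 < x" "0 < a" and g: "(g has_real_derivative g') (at (ln (x / a)))"
  shows "((\<lambda>x. x powr e * g (ln (x / a))) has_real_derivative
          x powr (e - 1) * (e * g (ln (x / a)) + g')) (at x)"
proof -
  have "((\<lambda>x. ln (x / a)) has_real_derivative 1 / x) (at x)"
    using x by (auto intro!: derivative_eq_intros)
  from DERIV_chain2[OF g this] have "((\<lambda>x. x powr e * g (ln (x / a))) has_real_derivative
      e * x powr (e - 1) * g (ln (x / a)) + g' * (1 / x) * x powr e) (at x)"
    using x by (intro DERIV_mult has_real_derivative_powr)
  moreover have "x powr e = x * x powr (e - 1)"
    using x by (simp add: powr_diff)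
  ultimately show ?thesis
    using x by (simp add: field_simps)
qed

lemma harmonic_addition:
  fixes e \<alpha> \<theta> :: real
  assumes "0 < e"
  shows "e * sin \<theta> + \<alpha> * cos \<theta> = sqrt (e\<^sup>2 + \<alpha>\<^sup>2) * sin (\<theta> + arctan (\<alpha> / e))"
proof -
  have "sqrt (e\<^sup>2 + \<alpha>\<^sup>2) = sqrt (e\<^sup>2 * (1 + (\<alpha> / e)\<^sup>2))"
    using assms by (simp add: power_divide field_simps)
  also have "\<dots> = e * sqrt (1 + (\<alpha> / e)\<^sup>2)"
    using assms by (simp add: real_sqrt_mult)
  finally have R: "sqrt (e\<^sup>2 + \<alpha>\<^sup>2) = e * sqrt (1 + (\<alpha> / e)\<^sup>2)" .
  have "sqrt (1 + (\<alpha> / e)\<^sup>2) > 0"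
    by (simp add: add_pos_nonneg)
  then show ?thesis
    using assms by (simp add: R sin_add cos_arctan sin_arctan distrib_left)
qed

section \<open>Existence of the least constant\<close>

text \<open>
  The least admissible constant exists because the inequality for each single \<open>f\<close> is closed in the
  constant; hence the infimum of all admissible constants is itself admissible.
\<close>

lemma hardy_const_between:
  assumes D: "hardy_bound p a b D" and c: "\<And>C. hardy_bound p a b C \<Longrightarrow> c \<le> C"
  shows "c \<le> hardy_const p a b" "hardy_const p a b \<le> D"
proof -
  let ?S = "{C. hardy_bound p a b C}"
  have bdd: "bdd_below ?S" using c by (intro bdd_belowI) auto
  define m where "m = Inf ?S"
  have "hardy_bound p a b m"
    unfolding hardy_bound_def
  proof
    fix f assume f: "f \<in> nonneg_Lp p a b"
    define N where "N = (LINT x:{a..b}|lebesgue. f x powr p)"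
    define G where "G = (LINT x:{a..b}|lebesgue. (1 / x * (LINT t:{a..x}|lebesgue. f t)) powr p)"
    have le: "G \<le> C * N" if "hardy_bound p a b C" for C
      using that f by (auto simp: hardy_bound_def G_def N_def)
    have "0 \<le> N"
      unfolding N_def set_lebesgue_integral_def by (intro integral_nonneg_AE) auto
    have "G \<le> m * N"
    proof (cases "N = 0")
      case True
      then show ?thesis using le[OF D] by simp
    next
      case False
      with \<open>0 \<le> N\<close> have "0 < N" by simp
      then have "G / N \<le> m"
        unfolding m_def using le D by (intro cInf_greatest) (auto simp: field_simps)
      with \<open>0 < N\<close> show ?thesis by (simp add: field_simps)
    qed
    then show "(LINT x:{a..b}|lebesgue. (1 / x * (LINT t:{a..x}|lebesgue. f t)) powr p)
       \<le> m * (LINT x:{a..b}|lebesgue. f x powr p)"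
      by (simp add: G_def N_def)
  qed
  then have "hardy_const p a b = Inf ?S"
    unfolding m_def hardy_const_def by (rule Least_equality) (auto intro: cInf_lower bdd)
  with bdd D c show "c \<le> hardy_const p a b" "hardy_const p a b \<le> D"
    by (auto intro!: cInf_lower cInf_greatest)
qed

section \<open>The sine test function\<close>

text \<open>
  The substitution \<open>x \<mapsto> a * b / x\<close> is the reflection \<open>s \<mapsto> L - s\<close> in logarithmic variables. It
  preserves \<open>dx/x\<close> and maps the angle \<open>\<alpha> * ln (x/a)\<close> to \<open>pi\<close> minus the shifted angle, so the sine
  is unchanged.
\<close>

lemma sine_integral_reflect:
  fixes a b \<alpha> \<phi> p :: real
  assumes ab: "0 < a" "a < b" and p: "0 < p" and \<alpha>: "0 < \<alpha>" and \<phi>: "0 < \<phi>"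
    and eq: "\<alpha> * ln (b / a) + \<phi> = pi"
  shows "((\<lambda>x. sin (\<alpha> * ln (x / a) + \<phi>) powr p / x) has_integral
      integral {a..b} (\<lambda>x. sin (\<alpha> * ln (x / a)) powr p / x)) {a..b}"
proof -
  let ?h = "\<lambda>x. sin (\<alpha> * ln (x / a)) powr p / x"
  have range: "0 \<le> \<alpha> * ln (x / a)" "\<alpha> * ln (x / a) \<le> pi" if "x \<in> {a..b}" for x
  proof -
    show "0 \<le> \<alpha> * ln (x / a)" using that ab \<alpha> by simp
    have "\<alpha> * ln (x / a) \<le> \<alpha> * ln (b / a)"
      using that ab \<alpha> by (intro mult_left_mono) (auto simp: divide_right_mono)
    then show "\<alpha> * ln (x / a) \<le> pi" using eq \<phi> by linarith
  qed
  have "((\<lambda>x. (- (a * b) / x\<^sup>2) *\<^sub>R ?h (a * b / x)) has_integral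
      (integral {a * b / a..a * b / b} ?h - integral {a * b / b..a * b / a} ?h)) {a..b}"
  proof (rule has_integral_substitution_general[of "{}"])
    show "(\<lambda>x. a * b / x) ` {a..b} \<subseteq> {a..b}"
      using ab by (auto simp: field_simps)
    show "continuous_on {a..b} ?h"
      using ab p range
      by (intro continuous_intros continuous_on_powr') (auto intro: sin_ge_zero)
    show "continuous_on {a..b} (\<lambda>x. a * b / x)"
      using ab by (intro continuous_intros) auto
    show "((\<lambda>x. a * b / x) has_real_derivative - (a * b) / x\<^sup>2) (at x within {a..b})"
      if "x \<in> {a..b} - {}" for x
      using ab that by (auto intro!: derivative_eq_intros simp: power2_eq_square)
  qed (use ab in auto)
  moreover have "integral {a * b / a..a * b / b} ?h = 0"
    using ab by simp
  ultimately have "((\<lambda>x. (- (a * b) / x\<^sup>2) *\<^sub>R ?h (a * b / x)) has_integral - integral {a..b} ?h) {a..b}"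
    using ab by simp
  from has_integral_neg[OF this]
  have "((\<lambda>x. - ((- (a * b) / x\<^sup>2) *\<^sub>R ?h (a * b / x))) has_integral integral {a..b} ?h) {a..b}"
    by simp
  then show ?thesis
  proof (rule has_integral_eq[rotated])
    fix x assume x: "x \<in> {a..b}"
    have "\<alpha> * ln (a * b / x / a) = \<alpha> * ln (b / a) - \<alpha> * ln (x / a)"
      using x ab by (simp add: ln_div ln_mult algebra_simps)
    also have "\<dots> = pi - (\<alpha> * ln (x / a) + \<phi>)" using eq by simp
    finally have "sin (\<alpha> * ln (a * b / x / a)) = sin (\<alpha> * ln (x / a) + \<phi>)"
      by (simp only: sin_pi_minus)
    then show "- ((- (a * b) / x\<^sup>2) *\<^sub>R ?h (a * b / x)) = sin (\<alpha> * ln (x / a) + \<phi>) powr p / x"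
      using x ab by (simp add: power2_eq_square field_simps)
  qed
qed

text \<open>
  The test function is the derivative of \<open>x\<^sup>e * sin (\<alpha> * ln (x/a))\<close>. The phase condition makes it
  vanish exactly at \<open>b\<close>, so it is nonnegative on \<open>[a,b]\<close>, and by the reflection both
  integrals of Hardy's inequality are multiples of one integral.
\<close>

lemma hardy_bound_ge_sine:
  fixes p a b \<alpha> C :: real
  defines "e \<equiv> 1 - 1 / p"
  assumes p: "1 < p" and ab: "0 < a" "a < b" and \<alpha>: "0 < \<alpha>"
    and eq: "\<alpha> * ln (b / a) + arctan (\<alpha> / e) = pi" and C: "hardy_bound p a b C"
  shows "(e\<^sup>2 + \<alpha>\<^sup>2) powr (- p / 2) \<le> C"
proof -
  define \<phi> where "\<phi> = arctan (\<alpha> / e)"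
  define R where "R = sqrt (e\<^sup>2 + \<alpha>\<^sup>2)"
  define \<theta> where "\<theta> x = \<alpha> * ln (x / a)" for x
  define f where "f x = x powr (e - 1) * (e * sin (\<theta> x) + \<alpha> * cos (\<theta> x))" for x
  define F where "F x = x powr e * sin (\<theta> x)" for x
  have e: "0 < e" "(e - 1) * p = -1" using p by (auto simp: e_def field_simps)
  have \<phi>: "0 < \<phi>" using \<alpha> e by (simp add: \<phi>_def)
  have R: "0 < R" using \<alpha> e by (simp add: R_def add_pos_pos)
  have eq': "\<theta> b + \<phi> = pi" using eq by (simp add: \<phi>_def \<theta>_def)
  have \<theta>: "0 \<le> \<theta> x" "\<theta> x + \<phi> \<le> pi" if "x \<in> {a..b}" for x
  proof -
    show "0 \<le> \<theta> x" using that ab \<alpha> by (simp add: \<theta>_def)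
    have "\<theta> x \<le> \<theta> b"
      unfolding \<theta>_def using that ab \<alpha> by (intro mult_left_mono) (auto simp: divide_right_mono)
    then show "\<theta> x + \<phi> \<le> pi" using eq' by linarith
  qed
  have f_eq: "f x = x powr (e - 1) * (R * sin (\<theta> x + \<phi>))" for x
    using e by (simp add: f_def R_def \<phi>_def harmonic_addition)
  have sin_nonneg: "0 \<le> sin (\<theta> x)" "0 \<le> sin (\<theta> x + \<phi>)" if "x \<in> {a..b}" for x
    using \<theta>[OF that] \<phi> by (auto intro!: sin_ge_zero)
  have f_nonneg: "0 \<le> f x" if "x \<in> {a..b}" for x
    unfolding f_eq using sin_nonneg[OF that] R by simp
  have cont_\<theta>: "continuous_on {a..b} \<theta>"
    unfolding \<theta>_def using ab by (intro continuous_intros) auto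
  have cont_f: "continuous_on {a..b} f"
    unfolding f_def using ab by (intro continuous_intros cont_\<theta>) auto
  have cont_fp: "continuous_on {a..b} (\<lambda>x. f x powr p)"
    using f_nonneg p by (intro continuous_on_powr' cont_f continuous_intros) auto
  have f_in: "f \<in> nonneg_Lp p a b"
    using absolutely_integrable_continuous_real[OF cont_f]
      absolutely_integrable_continuous_real[OF cont_fp] f_nonneg
    by (auto simp: nonneg_Lp_def set_integrable_def set_borel_measurable_def)
  have F_int: "(LINT t:{a..x}|lebesgue. f t) = F x" if x: "x \<in> {a..b}" for x
  proof -
    have "(f has_integral (F x - F a)) {a..x}"
    proof (rule fundamental_theorem_of_calculus)
      fix t assume t: "t \<in> {a..x}"
      have "((\<lambda>s. sin (\<alpha> * s)) has_real_derivative \<alpha> * cos (\<alpha> * ln (t / a))) (at (ln (t / a)))"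
        by (auto intro!: derivative_eq_intros)
      from DERIV_powr_times_comp_ln[OF _ _ this, of e]
      have "(F has_real_derivative f t) (at t)"
        using t ab by (simp add: F_def[abs_def] f_def \<theta>_def)
      then show "(F has_vector_derivative f t) (at t within {a..x})"
        by (simp add: has_real_derivative_iff_has_vector_derivative has_vector_derivative_at_within)
    qed (use x in auto)
    moreover have "set_integrable lebesgue {a..x} f"
      by (rule absolutely_integrable_continuous_real, rule continuous_on_subset[OF cont_f])
         (use x in auto)
    ultimately show ?thesis
      using ab by (simp add: set_lebesgue_integral_eq_integral(2) integral_unique F_def \<theta>_def)
  qed
  define I where "I = integral {a..b} (\<lambda>x. sin (\<theta> x) powr p / x)"
  have cont_h: "continuous_on {a..b} (\<lambda>x. sin (\<theta> x) powr p / x)"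
    using ab p sin_nonneg
    by (intro continuous_intros continuous_on_powr' cont_\<theta>) auto
  have powr_x: "(x powr (e - 1)) powr p = 1 / x" if "0 < x" for x
    using that e by (simp add: powr_powr powr_minus_divide)
  have "(LINT x:{a..b}|lebesgue. (1 / x * (LINT t:{a..x}|lebesgue. f t)) powr p)
      = (LINT x:{a..b}|lebesgue. sin (\<theta> x) powr p / x)"
  proof (rule set_lebesgue_integral_cong)
    show "\<forall>x. x \<in> {a..b} \<longrightarrow> (1 / x * (LINT t:{a..x}|lebesgue. f t)) powr p = sin (\<theta> x) powr p / x"
    proof (intro allI impI)
      fix x assume x: "x \<in> {a..b}"
      have "1 / x * F x = x powr (e - 1) * sin (\<theta> x)"
        using x ab by (simp add: F_def powr_diff)
      then show "(1 / x * (LINT t:{a..x}|lebesgue. f t)) powr p = sin (\<theta> x) powr p / x"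
        using x ab sin_nonneg[OF x] by (simp add: F_int powr_mult powr_x)
    qed
  qed simp
  also have "\<dots> = I"
    unfolding I_def
    by (rule set_lebesgue_integral_eq_integral(2)[OF absolutely_integrable_continuous_real[OF cont_h]])
  finally have lhs: "(LINT x:{a..b}|lebesgue. (1 / x * (LINT t:{a..x}|lebesgue. f t)) powr p) = I" .
  have "((\<lambda>x. R powr p * (sin (\<theta> x + \<phi>) powr p / x)) has_integral R powr p * I) {a..b}"
    unfolding I_def \<theta>_def
    by (intro has_integral_mult_right sine_integral_reflect)
       (use ab p \<alpha> \<phi> eq' in \<open>auto simp: \<theta>_def\<close>)
  then have "((\<lambda>x. f x powr p) has_integral R powr p * I) {a..b}"
  proof (rule has_integral_eq[rotated])
    fix x assume x: "x \<in> {a..b}"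
    then show "R powr p * (sin (\<theta> x + \<phi>) powr p / x) = f x powr p"
      using ab R sin_nonneg[OF x] by (simp add: f_eq powr_mult powr_x)
  qed
  then have rhs: "(LINT x:{a..b}|lebesgue. f x powr p) = R powr p * I"
    using set_lebesgue_integral_eq_integral(2)[OF absolutely_integrable_continuous_real[OF cont_fp]]
    by (simp add: integral_unique)
  have "I \<noteq> 0"
  proof
    assume "I = 0"
    then have "\<forall>x\<in>{a..b}. sin (\<theta> x) powr p / x = 0"
      unfolding I_def using ab by (subst (asm) integral_eq_0_iff[OF cont_h]) auto
    then have "sin (\<theta> b) = 0" using ab by (auto dest: bspec[of _ _ b])
    moreover have "sin (\<theta> b) = sin \<phi>" using eq' sin_pi_minus[of \<phi>] by (simp add: algebra_simps flip: eq')
    moreover have "\<phi> < pi"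
      using arctan_ubound[of "\<alpha> / e"] pi_gt_zero unfolding \<phi>_def by linarith
    then have "0 < sin \<phi>" using \<phi> by (intro sin_gt_zero)
    ultimately show False by simp
  qed
  moreover have "0 \<le> I"
    unfolding I_def using ab by (intro integral_nonneg integrable_continuous_real cont_h) auto
  ultimately have I: "0 < I" by simp
  have "I \<le> C * (R powr p * I)"
    using C[unfolded hardy_bound_def, rule_format, OF f_in] by (simp only: lhs rhs)
  then have "1 \<le> C * R powr p" using I by simp
  then have "R powr (- p) \<le> C" using R by (simp add: powr_minus_divide divide_le_eq)
  moreover have "R powr (- p) = (e\<^sup>2 + \<alpha>\<^sup>2) powr (- p / 2)"
    by (simp add: R_def powr_half_sqrt[symmetric] powr_powr)
  ultimately show ?thesis by simp
qed

section \<open>A weight for the upper bound\<close>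

text \<open>
  The differential inequality for the linear profile, after division by the constants. By
  Bernoulli's inequality the first product loses at most \<open>((p-1) * y)\<^sup>2 \<le> 1/(4 L\<^sup>2)\<close>, while the
  slope term gains at least \<open>1/(3 L\<^sup>2)\<close>, because \<open>(1 + y)\<^sup>p\<^sup>-\<^sup>2 \<ge> (1/2) / (3/2)\<close>. What remains is
  \<open>1/3 - 1/4 = 1/12\<close>.
\<close>

lemma profile_inequality:
  fixes p L y :: real
  assumes p: "2 \<le> p" and L: "1 \<le> L" and y: "\<bar>y\<bar> \<le> 1 / (2 * p * L)"
  shows "1 + 1 / (12 * L\<^sup>2) \<le> (1 + y) powr (p - 2) * ((1 + y) * (1 - (p - 1) * y) + 1 / L\<^sup>2)"
proof -
  have "(p - 1) * \<bar>y\<bar> \<le> p * (1 / (2 * p * L))"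
    using p L y by (intro mult_mono) auto
  also have "\<dots> = 1 / (2 * L)" using p by simp
  finally have py: "(p - 1) * \<bar>y\<bar> \<le> 1 / (2 * L)" .
  also have "\<dots> \<le> 1 / 2" using L by (simp add: field_simps)
  finally have py_half: "(p - 1) * \<bar>y\<bar> \<le> 1 / 2" .
  have "1 * \<bar>y\<bar> \<le> (p - 1) * \<bar>y\<bar>" using p by (intro mult_right_mono) auto
  with py_half have y_half: "\<bar>y\<bar> \<le> 1 / 2" by linarith
  then have pos: "0 < 1 + y" by linarith
  have py': "\<bar>(p - 1) * y\<bar> \<le> 1 / (2 * L)" "\<bar>(p - 1) * y\<bar> \<le> 1 / 2"
    using py py_half p by (simp_all add: abs_mult)
  have bern: "1 + (p - 1) * y \<le> (1 + y) powr (p - 1)"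
    using p y_half by (intro bernoulli_powr) auto
  have split: "(1 + y) powr (p - 2) * (1 + y) = (1 + y) powr (p - 1)"
    using pos powr_add[of "1 + y" "p - 2" 1] by simp
  have "1 / 2 \<le> (1 + y) powr (p - 2) * (1 + y)"
    using bern py' split by linarith
  also have "\<dots> \<le> (1 + y) powr (p - 2) * (3 / 2)"
    using y_half by (intro mult_left_mono) auto
  finally have third: "1 / 3 \<le> (1 + y) powr (p - 2)" by simp
  have "((p - 1) * y)\<^sup>2 \<le> (1 / (2 * L))\<^sup>2"
    using py'(1) by (intro iffD1[OF abs_le_square_iff]) (use L in auto)
  then have sq: "((p - 1) * y)\<^sup>2 \<le> 1 / 4 * (1 / L\<^sup>2)"
    by (simp add: power2_eq_square)
  have "1 - 1 / 4 * (1 / L\<^sup>2) \<le> (1 + (p - 1) * y) * (1 - (p - 1) * y)"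
    using sq by (simp add: power2_eq_square algebra_simps)
  also have "\<dots> \<le> (1 + y) powr (p - 1) * (1 - (p - 1) * y)"
    using bern py'(2) by (intro mult_right_mono) linarith+
  also have "\<dots> = (1 + y) powr (p - 2) * ((1 + y) * (1 - (p - 1) * y))"
    using split by (simp add: mult.assoc[symmetric])
  finally have "1 - 1 / 4 * (1 / L\<^sup>2) \<le> (1 + y) powr (p - 2) * ((1 + y) * (1 - (p - 1) * y))" .
  moreover have "1 / 3 * (1 / L\<^sup>2) \<le> (1 + y) powr (p - 2) * (1 / L\<^sup>2)"
    using third by (intro mult_right_mono) auto
  moreover have "1 / (12 * L\<^sup>2) = 1 / 3 * (1 / L\<^sup>2) - 1 / 4 * (1 / L\<^sup>2)"
    by simp
  ultimately show ?thesis
    by (simp only: distrib_left)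
qed

text \<open>
  With \<open>u = e + g'/g\<close> and \<open>H = D * k\<^sup>p\<^sup>-\<^sup>1\<close>, the Schur test asks for
  \<open>D * (p - 1) * u\<^sup>p\<^sup>-\<^sup>2 * (u * (1 - u) - u') \<ge> 1\<close>. The term \<open>u\<^sup>p\<^sup>-\<^sup>1 * (1 - u)\<close> has its maximum at
  \<open>u = e\<close>, where it yields the classical constant, and only \<open>u' < 0\<close> can improve on it. Letting \<open>u\<close> decrease
  linearly through \<open>e\<close> with slope of order \<open>1/L\<^sup>2\<close> keeps \<open>u - e\<close> of order \<open>1/L\<close>, so the loss
  from leaving the maximum is quadratic in the small slope factor and the gain is linear in it.
  The factor \<open>1/p\<close> in the slope makes the gain prevail. The corresponding \<open>g\<close> is a Gaussian.
\<close>

lemma hardy_bound_linear_profile: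
  fixes p a b :: real
  assumes p: "2 \<le> p" and ab: "0 < a" "a < b" and L1: "1 \<le> ln (b / a)"
  shows "hardy_bound p a b ((p / (p - 1)) powr p / (1 + 1 / (12 * (ln (b / a))\<^sup>2)))"
proof -
  define L where "L = ln (b / a)"
  define e where "e = 1 - 1 / p"
  define D where "D = (p / (p - 1)) powr p / (1 + 1 / (12 * L\<^sup>2))"
  \<comment> \<open>\<open>y\<close> is the relative deviation of \<open>u\<close> from \<open>e\<close>, and \<open>g\<close> is obtained from \<open>g'/g = e * y\<close>.\<close>
  define y where "y s = (1 / 2 - s / L) / (p * L)" for s
  define u where "u s = e * (1 + y s)" for s
  define g where "g s = exp (e * ((s / 2 - s\<^sup>2 / (2 * L)) / (p * L)))" for s
  define K where "K x = x powr e * g (ln (x / a))" for x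
  define k where "k x = x powr (e - 1) * (g (ln (x / a)) * u (ln (x / a)))" for x
  define H where "H x = D * k x powr (p - 1)" for x
  define k' where "k' x = x powr (e - 2) * g (ln (x / a)) *
      (u (ln (x / a)) ^ 2 - u (ln (x / a)) - e / (p * L\<^sup>2))" for x
  define H' where "H' x = D * ((p - 1) * k x powr (p - 2) * k' x)" for x
  have L: "1 \<le> L" using L1 by (simp add: L_def)
  have e: "0 < e" using p by (auto simp: e_def field_simps)
  have pe: "p - 1 = p * e" using p by (auto simp: e_def field_simps)
  have D: "0 < D"
    using p L by (simp add: D_def add_pos_nonneg)
  have g_pos: "0 < g s" for s by (simp add: g_def)
  have y_bound: "\<bar>y s\<bar> \<le> 1 / (2 * p * L)" if "0 \<le> s" "s \<le> L" for s
  proof -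
    have "\<bar>1 / 2 - s / L\<bar> \<le> 1 / 2" using that L by (auto simp: abs_le_iff field_simps)
    then have "\<bar>1 / 2 - s / L\<bar> / (p * L) \<le> (1 / 2) / (p * L)"
      using p L by (intro divide_right_mono) auto
    then show ?thesis using p L by (simp add: y_def abs_divide mult.assoc)
  qed
  have y_gt: "-1 < y s" if "0 \<le> s" "s \<le> L" for s
  proof -
    have "1 * 1 < 2 * p * L" using p L by (intro mult_less_le_imp_less) auto
    then have "1 / (2 * p * L) < 1" using p L by (subst divide_less_eq_1_pos) auto
    then show ?thesis using y_bound[OF that] by linarith
  qed
  have u_pos: "0 < u s" if "0 \<le> s" "s \<le> L" for s
    using y_gt[OF that] e by (simp add: u_def)
  have g_deriv: "(g has_real_derivative g s * (u s - e)) (at s)" for s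
    unfolding g_def u_def y_def using L p
    by (auto intro!: derivative_eq_intros simp: field_simps power2_eq_square)
  have u_deriv: "(u has_real_derivative - (e / (p * L\<^sup>2))) (at s)" for s
    unfolding u_def y_def using L p
    by (auto intro!: derivative_eq_intros simp: field_simps power2_eq_square)
  have s_range: "0 \<le> ln (x / a)" "ln (x / a) \<le> L" if "x \<in> {a..b}" for x
    using that ab by (auto simp: L_def divide_right_mono)
  have K_deriv: "(K has_real_derivative k x) (at x)" if "x \<in> {a..b}" for x
    using DERIV_powr_times_comp_ln[OF _ _ g_deriv, of x a e] that ab
    by (simp add: K_def[abs_def] k_def algebra_simps)
  have k_deriv: "(k has_real_derivative k' x) (at x)" if "x \<in> {a..b}" for x
  proof -
    have "((\<lambda>s. g s * u s) has_real_derivative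
        g s * (u s - e) * u s + - (e / (p * L\<^sup>2)) * g s) (at s)" for s
      by (rule DERIV_mult[OF g_deriv u_deriv])
    from DERIV_powr_times_comp_ln[OF _ _ this, of x a "e - 1"] show ?thesis
      using that ab by (simp add: k_def[abs_def] k'_def power2_eq_square algebra_simps)
  qed
  have k_pos: "0 < k x" if "x \<in> {a..b}" for x
    using that ab g_pos u_pos[OF s_range[OF that]] by (simp add: k_def)
  have H_deriv: "(H has_real_derivative H' x) (at x)" if "x \<in> {a..b}" for x
    using DERIV_cmult[OF DERIV_chain2[OF has_real_derivative_powr[OF k_pos[OF that], of "p - 1"] k_deriv[OF that]], of D]
    by (simp add: H_def[abs_def] H'_def)
  have "hardy_bound p a b D"
  proof (rule hardy_bound_schur_test[OF _ ab _ K_deriv _ _ _ H_deriv])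
    show "continuous_on {a..b} k"
      using k_deriv by (meson DERIV_isCont continuous_at_imp_continuous_on)
    show "0 \<le> K a" using ab g_pos[of "ln (a / a)"] by (simp add: K_def)
    show "0 \<le> H b" using D by (simp add: H_def)
    show "H x \<le> D * k x powr (p - 1)" for x by (simp add: H_def)
    fix x assume x: "x \<in> {a..b}"
    define s where "s = ln (x / a)"
    have s: "0 \<le> s" "s \<le> L" using s_range[OF x] by (auto simp: s_def)
    have x0: "0 < x" using x ab by simp
    have ypos: "0 < 1 + y s" using y_gt[OF s] by simp
    have pow_x: "(x powr (e - 1)) powr (p - 2) * x powr (e - 2) = (x powr e) powr (p - 1) * x powr (- p)"
      using x0 by (simp add: powr_powr algebra_simps flip: powr_add)
    have pow_g: "g s powr (p - 2) * g s = g s powr (p - 1)"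
      using g_pos[of s] powr_add[of "g s" "p - 2" 1] by simp
    have "(p - 1) * (u s powr (p - 2) * (u s - u s ^ 2 + e / (p * L\<^sup>2)))
      = (p - 1) * (e powr (p - 2) * (1 + y s) powr (p - 2) *
          (e / p * ((1 + y s) * (1 - (p - 1) * y s) + 1 / L\<^sup>2)))"
    proof -
      have "u s - u s ^ 2 = e * (1 + y s) * (1 - e - e * y s)"
        by (simp add: u_def power2_eq_square algebra_simps)
      also have "1 - e - e * y s = 1 / p * (1 - (p - 1) * y s)"
        using p by (simp add: e_def field_simps)
      finally have "u s - u s ^ 2 + e / (p * L\<^sup>2) = e / p * ((1 + y s) * (1 - (p - 1) * y s) + 1 / L\<^sup>2)"
        by (simp add: distrib_left)
      then show ?thesis using e ypos by (simp add: u_def powr_mult)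
    qed
    also have "\<dots> = e powr p * ((1 + y s) powr (p - 2) * ((1 + y s) * (1 - (p - 1) * y s) + 1 / L\<^sup>2))"
    proof -
      have "(p - 1) * e powr (p - 2) * (e / p) = e powr p"
        using p e pe powr_add[of e "p - 2" 2] by (simp add: power2_eq_square)
      moreover have "(p - 1) * (e powr (p - 2) * (1 + y s) powr (p - 2) *
          (e / p * ((1 + y s) * (1 - (p - 1) * y s) + 1 / L\<^sup>2)))
        = ((p - 1) * e powr (p - 2) * (e / p)) *
          ((1 + y s) powr (p - 2) * ((1 + y s) * (1 - (p - 1) * y s) + 1 / L\<^sup>2))"
        by (simp only: mult_ac)
      ultimately show ?thesis by simp
    qed
    also have "\<dots> \<ge> e powr p * (1 + 1 / (12 * L\<^sup>2))"
      by (intro mult_left_mono profile_inequality p L y_bound s) simp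
    finally have "D * (e powr p * (1 + 1 / (12 * L\<^sup>2)))
      \<le> D * ((p - 1) * (u s powr (p - 2) * (u s - u s ^ 2 + e / (p * L\<^sup>2))))"
      using D by (intro mult_left_mono) auto
    moreover have "D * (e powr p * (1 + 1 / (12 * L\<^sup>2))) = 1"
    proof -
      have "1 + 1 / (12 * L\<^sup>2) \<noteq> 0" using L by (intro less_imp_neq[symmetric] add_pos_nonneg) auto
      moreover have "(p / (p - 1)) powr p * e powr p = 1"
      proof -
        have "(p / (p - 1)) powr p * e powr p = (p / (p - 1) * e) powr p"
          by (subst powr_mult) (use p e in auto)
        also have "p / (p - 1) * e = 1" using p by (simp add: e_def field_simps)
        finally show ?thesis by simp
      qed
      ultimately show ?thesis by (simp add: D_def)
    qed
    ultimately have key: "1 \<le> D * ((p - 1) * (u s powr (p - 2) * (u s - u s ^ 2 + e / (p * L\<^sup>2))))"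
      by simp
    have "- H' x = D * ((p - 1) * ((x powr (e - 1) * (g s * u s)) powr (p - 2)
        * (x powr (e - 2) * g s * (u s - u s ^ 2 + e / (p * L\<^sup>2)))))"
    proof -
      have "u s ^ 2 - u s - e / (p * L\<^sup>2) = - (u s - u s ^ 2 + e / (p * L\<^sup>2))" by simp
      then have "k' x = - (x powr (e - 2) * g s * (u s - u s ^ 2 + e / (p * L\<^sup>2)))"
        by (simp only: k'_def s_def[symmetric] mult_minus_right)
      then show ?thesis
        by (simp only: H'_def k_def s_def[symmetric] mult_minus_right minus_minus mult.assoc)
    qed
    also have "(x powr (e - 1) * (g s * u s)) powr (p - 2)
        = (x powr (e - 1)) powr (p - 2) * (g s powr (p - 2) * u s powr (p - 2))"
      using x0 g_pos[of s] u_pos[OF s] by (simp add: powr_mult)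
    also have "D * ((p - 1) * ((x powr (e - 1)) powr (p - 2) * (g s powr (p - 2) * u s powr (p - 2))
        * (x powr (e - 2) * g s * (u s - u s ^ 2 + e / (p * L\<^sup>2)))))
      = ((x powr (e - 1)) powr (p - 2) * x powr (e - 2)) * (g s powr (p - 2) * g s)
        * (D * ((p - 1) * (u s powr (p - 2) * (u s - u s ^ 2 + e / (p * L\<^sup>2)))))"
      by (simp only: mult_ac)
    also have "\<dots> \<ge> ((x powr (e - 1)) powr (p - 2) * x powr (e - 2)) * (g s powr (p - 2) * g s) * 1"
      using key g_pos[of s] by (intro mult_left_mono) auto
    also have "((x powr (e - 1)) powr (p - 2) * x powr (e - 2)) * (g s powr (p - 2) * g s) * 1
        = K x powr (p - 1) * x powr (- p)"
      using x0 g_pos[of s] by (simp add: pow_x pow_g K_def powr_mult flip: s_def)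
    finally show "K x powr (p - 1) * x powr (- p) \<le> - H' x" .
  qed (use p D k_pos in auto)
  then show ?thesis by (simp add: D_def L_def)
qed

section \<open>The exact constant in the quadratic case\<close>

text \<open>
  For \<open>p = 2\<close> the extremal function of the lower bound also serves as the weight in the Schur test:
  \<open>K x = sqrt x * sin (\<alpha> * ln (x/a))\<close> is an Euler-Lagrange solution, and the phase condition is
  the natural boundary condition \<open>K' b = 0\<close>. Hence \<open>H = D * K'\<close> fulfils the requirements on \<open>H\<close>
  with equality.
\<close>

lemma hardy_const_two:
  fixes a b \<alpha> :: real
  assumes ab: "0 < a" "a < b" and \<alpha>: "0 < \<alpha>" and eq: "\<alpha> * ln (b / a) + arctan (2 * \<alpha>) = pi"
  shows "hardy_const 2 a b = 4 / (1 + 4 * \<alpha>\<^sup>2)"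
proof -
  define D where "D = 4 / (1 + 4 * \<alpha>\<^sup>2)"
  define \<theta> where "\<theta> x = \<alpha> * ln (x / a)" for x
  define K where "K x = x powr (1/2) * sin (\<theta> x)" for x
  define k where "k x = x powr (1/2 - 1) * (1/2 * sin (\<theta> x) + \<alpha> * cos (\<theta> x))" for x
  define k' where "k' x = x powr (1/2 - 1 - 1) * (- (1/4 + \<alpha>\<^sup>2) * sin (\<theta> x))" for x
  have pos: "0 < 1 + 4 * \<alpha>\<^sup>2" by (simp add: add_pos_nonneg)
  have eq': "\<theta> b + arctan (2 * \<alpha>) = pi" using eq by (simp add: \<theta>_def)
  have \<theta>0: "0 \<le> \<theta> x" if "x \<in> {a..b}" for x
    using that ab \<alpha> by (simp add: \<theta>_def)
  have \<theta>_le: "\<theta> x + arctan (2 * \<alpha>) \<le> pi" if "x \<in> {a..b}" for x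
  proof -
    have "\<theta> x \<le> \<theta> b"
      unfolding \<theta>_def using that ab \<alpha> by (intro mult_left_mono) (auto simp: divide_right_mono)
    then show ?thesis using eq' by linarith
  qed
  have \<theta>_less: "\<theta> x + arctan (2 * \<alpha>) < pi" if "x \<in> {a..<b}" for x
  proof -
    have "\<theta> x < \<theta> b"
      unfolding \<theta>_def using that ab \<alpha> by (intro mult_strict_left_mono) (auto simp: divide_strict_right_mono)
    then show ?thesis using eq' by linarith
  qed
  have k_eq: "k x = x powr (1/2 - 1) * (sqrt ((1/2)\<^sup>2 + \<alpha>\<^sup>2) * sin (\<theta> x + arctan (2 * \<alpha>)))" for x
    using harmonic_addition[of "1/2" "\<theta> x" \<alpha>] by (simp add: k_def mult.commute)
  have R: "0 < sqrt ((1/2)\<^sup>2 + \<alpha>\<^sup>2)" by (simp add: add_pos_nonneg)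
  have phi: "0 < arctan (2 * \<alpha>)" using \<alpha> by simp
  have k_pos: "0 < k x" if "x \<in> {a..<b}" for x
    unfolding k_eq using that ab \<theta>0[of x] \<theta>_less[OF that] R phi
    by (intro mult_pos_pos sin_gt_zero add_nonneg_pos) auto
  have sin_deriv: "((\<lambda>s. sin (\<alpha> * s)) has_real_derivative \<alpha> * cos (\<alpha> * s)) (at s)" for s
    by (auto intro!: derivative_eq_intros)
  have K_deriv: "(K has_real_derivative k x) (at x)" if "x \<in> {a..b}" for x
    using DERIV_powr_times_comp_ln[OF _ _ sin_deriv, of x a "1/2"] that ab
    by (simp add: K_def[abs_def] k_def \<theta>_def)
  have k_deriv: "(k has_real_derivative k' x) (at x)" if "x \<in> {a..b}" for x
  proof -
    have g: "((\<lambda>s. 1/2 * sin (\<alpha> * s) + \<alpha> * cos (\<alpha> * s)) has_real_derivative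
        1/2 * (\<alpha> * cos (\<alpha> * s)) - \<alpha>\<^sup>2 * sin (\<alpha> * s)) (at s)" for s
      by (auto intro!: derivative_eq_intros simp: power2_eq_square)
    have "(k has_real_derivative x powr (1/2 - 1 - 1) * ((1/2 - 1) * (1/2 * sin (\<theta> x) + \<alpha> * cos (\<theta> x))
        + (1/2 * (\<alpha> * cos (\<theta> x)) - \<alpha>\<^sup>2 * sin (\<theta> x)))) (at x)"
      unfolding k_def[abs_def] \<theta>_def
      by (rule DERIV_powr_times_comp_ln[OF _ _ g]) (use that ab in auto)
    moreover have "(1/2 - 1) * (1/2 * sin (\<theta> x) + \<alpha> * cos (\<theta> x))
        + (1/2 * (\<alpha> * cos (\<theta> x)) - \<alpha>\<^sup>2 * sin (\<theta> x)) = - (1/4 + \<alpha>\<^sup>2) * sin (\<theta> x)"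
      by (simp add: algebra_simps)
    ultimately show ?thesis by (simp only: k'_def)
  qed
  have "hardy_bound 2 a b D"
  proof (rule hardy_bound_schur_test[OF _ ab _ K_deriv _ _ k_pos])
    show "continuous_on {a..b} k"
      using k_deriv by (meson DERIV_isCont continuous_at_imp_continuous_on)
    show "((\<lambda>x. D * k x) has_real_derivative D * k' x) (at x)" if "x \<in> {a..b}" for x
      by (intro DERIV_cmult k_deriv that)
    show "0 \<le> K a" by (simp add: K_def \<theta>_def)
    show "0 \<le> D" using pos by (simp add: D_def)
    then show "0 \<le> D * k b"
      using eq' by (simp add: k_eq)
    show "D * k x \<le> D * k x powr (2 - 1)" if "x \<in> {a..<b}" for x
      using k_pos[OF that] by simp
    fix x assume x: "x \<in> {a..b}"
    have "0 \<le> sin (\<theta> x)"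
      by (rule sin_ge_zero) (use \<theta>0[OF x] \<theta>_le[OF x] phi in linarith)+
    then have "K x powr (2 - 1) * x powr (- 2) = x powr (1/2) * x powr (- 2) * sin (\<theta> x)"
      using x ab by (simp add: K_def)
    also have "x powr (1/2) * x powr (- 2) = x powr (1/2 - 1 - 1)"
      using x ab by (simp flip: powr_add)
    also have "\<dots> * sin (\<theta> x) = - (D * k' x)"
    proof -
      have "D * (1/4 + \<alpha>\<^sup>2) = 1" using pos by (simp add: D_def field_simps)
      moreover have "- (D * k' x) = D * (1/4 + \<alpha>\<^sup>2) * (x powr (1/2 - 1 - 1) * sin (\<theta> x))"
        unfolding k'_def by (simp only: mult_minus_left mult_minus_right minus_minus mult_ac)
      ultimately show ?thesis by simp
    qed
    finally show "K x powr (2 - 1) * x powr (- 2) \<le> - (D * k' x)" by simp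
  qed auto
  moreover have "D \<le> C" if "hardy_bound 2 a b C" for C
  proof -
    have "((1 - 1 / 2)\<^sup>2 + \<alpha>\<^sup>2) powr (- 2 / 2) \<le> C"
      by (rule hardy_bound_ge_sine[OF _ ab \<alpha> _ that]) (use eq in \<open>simp_all add: mult.commute\<close>)
    moreover have "((1 - 1 / 2)\<^sup>2 + \<alpha>\<^sup>2) powr (- 2 / 2) = D"
      using pos by (simp add: D_def powr_minus_divide power2_eq_square field_simps)
    ultimately show ?thesis by simp
  qed
  ultimately show ?thesis
    using hardy_const_between[of 2 a b D D] by (simp add: D_def)
qed

section \<open>Asymptotics in the logarithm\<close>

lemma frequency_exists:
  fixes L e :: real
  assumes "0 < L" "0 < e"
  obtains \<alpha> where "0 < \<alpha>" "\<alpha> < pi / L" "\<alpha> * L + arctan (\<alpha> / e) = pi"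
proof -
  have "\<exists>\<alpha>\<ge>0. \<alpha> \<le> pi / L \<and> \<alpha> * L + arctan (\<alpha> / e) = pi"
    by (rule IVT') (use assms in \<open>auto intro!: continuous_intros\<close>)
  then obtain \<alpha> where \<alpha>: "0 \<le> \<alpha>" "\<alpha> \<le> pi / L" "\<alpha> * L + arctan (\<alpha> / e) = pi" by blast
  then have "0 < \<alpha>" by (cases "\<alpha> = 0") auto
  then have "\<alpha> * L < pi" using \<alpha>(3) assms by (simp add: eq_diff_eq[symmetric])
  with \<open>0 < \<alpha>\<close> \<alpha> assms show ?thesis by (intro that) (auto simp: field_simps)
qed


lemma hardy_const_le:
  fixes p a b :: real
  defines "L \<equiv> ln (b / a)"
  assumes p: "2 \<le> p" and ab: "0 < a" "a < b" and L: "1 \<le> L"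
  shows "hardy_const p a b \<le> (p / (p - 1)) powr p - (p / (p - 1)) powr p / 24 / L\<^sup>2"
proof -
  let ?Q = "(p / (p - 1)) powr p"
  obtain \<alpha> where \<alpha>: "0 < \<alpha>" "\<alpha> * L + arctan (\<alpha> / (1 - 1 / p)) = pi"
    using frequency_exists[of L "1 - 1 / p"] p L by auto
  have "hardy_const p a b \<le> ?Q / (1 + 1 / (12 * L\<^sup>2))"
    unfolding L_def
    by (rule hardy_const_between(2)[OF hardy_bound_linear_profile[OF p ab] hardy_bound_ge_sine[OF _ ab \<alpha>(1)]])
       (use p L \<alpha>(2) in \<open>auto simp: L_def\<close>)
  also have "\<dots> \<le> ?Q * (1 - 1 / (24 * L\<^sup>2))"
  proof -
    define t where "t = 1 / (12 * L\<^sup>2)"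
    have "1 \<le> L\<^sup>2" using L by simp
    then have "0 < 12 * L\<^sup>2" "1 \<le> 12 * L\<^sup>2" by linarith+
    then have t: "0 < t" "t \<le> 1" by (auto simp only: t_def zero_less_divide_1_iff divide_le_eq_1_pos)
    have "t * t \<le> 1 * t" using t by (intro mult_right_mono) auto
    then have "1 \<le> (1 - t / 2) * (1 + t)" using t by (simp add: algebra_simps)
    then have "1 / (1 + t) \<le> 1 - t / 2" using t by (simp add: pos_divide_le_eq)
    then have "?Q * (1 / (1 + t)) \<le> ?Q * (1 - t / 2)" by (intro mult_left_mono) auto
    then show ?thesis by (simp add: t_def)
  qed
  finally show ?thesis by (simp add: right_diff_distrib)
qed

text \<open>
  With \<open>t = (q * \<alpha>)\<^sup>2\<close> the sine test gives \<open>q\<^sup>p * (1 + t)\<^sup>-\<^sup>p\<^sup>/\<^sup>2 \<ge> q\<^sup>p * (1 - (p/2) * t)\<close>, that is a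
  loss of at most \<open>(p/2) * q\<^sup>p\<^sup>+\<^sup>2 * pi\<^sup>2 / L\<^sup>2\<close>. Since \<open>p \<ge> 2\<close> means \<open>q \<le> 2\<close>, one factor \<open>q/2\<close>
  can be dropped.
\<close>

lemma hardy_const_ge:
  fixes p a b :: real
  defines "L \<equiv> ln (b / a)" and "q \<equiv> p / (p - 1)"
  assumes p: "2 \<le> p" and ab: "0 < a" "a < b" and L: "1 \<le> L"
  shows "q powr p - q powr (p + 1) * p * pi\<^sup>2 / L\<^sup>2 \<le> hardy_const p a b"
proof -
  define e where "e = 1 - 1 / p"
  have e: "0 < e" "q = 1 / e" and q: "0 < q" "q \<le> 2" using p by (auto simp: e_def q_def field_simps)
  obtain \<alpha> where \<alpha>: "0 < \<alpha>" "\<alpha> < pi / L" "\<alpha> * L + arctan (\<alpha> / e) = pi"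
    using frequency_exists[of L e] e L by auto
  have lower: "(e\<^sup>2 + \<alpha>\<^sup>2) powr (- p / 2) \<le> hardy_const p a b"
    unfolding e_def
    by (rule hardy_const_between(1)[OF hardy_bound_linear_profile[OF p ab] hardy_bound_ge_sine[OF _ ab \<alpha>(1)]])
       (use p L \<alpha>(3) in \<open>auto simp: L_def e_def\<close>)
  define t where "t = (q * \<alpha>)\<^sup>2"
  have t: "0 \<le> t" by (simp add: t_def)
  have eq: "(e\<^sup>2 + \<alpha>\<^sup>2) powr (- p / 2) = q powr p * (1 / ((1 + t) powr (p / 2)))"
  proof -
    have "e\<^sup>2 + \<alpha>\<^sup>2 = e\<^sup>2 * (1 + t)"
      using e(1) by (simp add: t_def e(2) power_divide distrib_left)
    moreover have "(e\<^sup>2) powr (- p / 2) = q powr p"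
      using e by (simp add: powr_divide powr_minus_divide powr_powr flip: powr_numeral)
    ultimately have "(e\<^sup>2 + \<alpha>\<^sup>2) powr (- p / 2) = q powr p * (1 + t) powr (- p / 2)"
      using t by (simp only: powr_mult)
    then show ?thesis by (simp add: powr_minus_divide)
  qed
  have "1 - p / 2 * t \<le> 1 / ((1 + t) powr (p / 2))"
  proof -
    have "1 - p / 2 * t \<le> 1 - p / 2 * (t / (1 + t))"
      using p t by (intro diff_left_mono mult_left_mono) (auto simp: divide_le_eq algebra_simps)
    also have "\<dots> = 1 + p / 2 * (- (t / (1 + t)))"
      by simp
    \<comment> \<open>Bernoulli's inequality, applied to \<open>1/(1 + t)\<close> because its exponent has to be at least \<open>1\<close>.\<close>
    also have "\<dots> \<le> (1 + - (t / (1 + t))) powr (p / 2)"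
      using p t by (intro bernoulli_powr) (auto simp: divide_le_eq)
    also have "1 + - (t / (1 + t)) = 1 / (1 + t)"
      using t by (simp add: field_simps)
    also have "(1 / (1 + t)) powr (p / 2) = 1 / ((1 + t) powr (p / 2))"
      using t by (simp add: powr_divide)
    finally show ?thesis .
  qed
  then have "q powr p * (1 - p / 2 * t) \<le> q powr p * (1 / ((1 + t) powr (p / 2)))"
    by (intro mult_left_mono) auto
  with lower eq have "q powr p * (1 - p / 2 * t) \<le> hardy_const p a b"
    by linarith
  moreover have "q powr p * (p / 2 * t) \<le> q powr (p + 1) * p * pi\<^sup>2 / L\<^sup>2"
  proof -
    have "\<alpha>\<^sup>2 \<le> (pi / L)\<^sup>2" using \<alpha> by (intro power_mono) auto
    then have "q powr p * (p / 2 * t) \<le> q powr p * (p / 2 * (q\<^sup>2 * (pi / L)\<^sup>2))"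
      unfolding t_def using p by (simp add: power_mult_distrib mult_left_mono)
    also have "\<dots> = (q powr p * q) * p * (pi / L)\<^sup>2 * (q / 2)"
      by (simp add: power2_eq_square mult_ac)
    also have "\<dots> \<le> (q powr p * q) * p * (pi / L)\<^sup>2 * 1"
      using p q by (intro mult_left_mono) auto
    also have "\<dots> = q powr (p + 1) * p * pi\<^sup>2 / L\<^sup>2"
      using q by (simp add: powr_add power_divide)
    finally show ?thesis .
  qed
  ultimately show ?thesis by (simp add: right_diff_distrib)
qed

text \<open>
  By the exact value, \<open>L\<^sup>2 * (4 - d(a,b)) = 16 * (\<alpha> * L)\<^sup>2 / (1 + 4 \<alpha>\<^sup>2)\<close>, and the phase condition with
  \<open>arctan (2 \<alpha>) \<le> 2 \<alpha> < 2 pi / L\<close> encloses \<open>\<alpha> * L\<close> between \<open>pi - 2 pi / L\<close> and \<open>pi\<close>.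
\<close>

lemma hardy_const_two_bounds:
  fixes a b :: real
  defines "L \<equiv> ln (b / a)"
  assumes ab: "0 < a" "a < b" and L: "2 \<le> L"
  shows "16 * (pi - 2 * pi / L)\<^sup>2 / (1 + 4 * (pi / L)\<^sup>2) \<le> L\<^sup>2 * (4 - hardy_const 2 a b)"
    "L\<^sup>2 * (4 - hardy_const 2 a b) \<le> 16 * pi\<^sup>2"
proof -
  obtain \<alpha> where \<alpha>: "0 < \<alpha>" "\<alpha> < pi / L" "\<alpha> * L + arctan (\<alpha> / (1/2)) = pi"
    using frequency_exists[of L "1/2"] L by auto
  have eq: "\<alpha> * L + arctan (2 * \<alpha>) = pi" using \<alpha>(3) by (simp add: mult.commute)
  have pos: "0 < 1 + 4 * \<alpha>\<^sup>2" by (simp add: add_pos_nonneg)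
  have "hardy_const 2 a b = 4 / (1 + 4 * \<alpha>\<^sup>2)"
    using hardy_const_two[OF ab \<alpha>(1)] eq by (simp add: L_def)
  then have val: "L\<^sup>2 * (4 - hardy_const 2 a b) = 16 * (\<alpha> * L)\<^sup>2 / (1 + 4 * \<alpha>\<^sup>2)"
    using pos by (simp add: field_simps power_mult_distrib)
  have upper: "\<alpha> * L \<le> pi" using \<alpha> L by (simp add: field_simps)
  have "arctan (2 * \<alpha>) \<le> 2 * \<alpha>" using \<alpha> by (intro arctan_le_self) auto
  also have "\<dots> \<le> 2 * pi / L" using \<alpha>(2) by simp
  finally have lower: "pi - 2 * pi / L \<le> \<alpha> * L" using eq by linarith
  have "0 \<le> pi - 2 * pi / L" using L by (simp add: field_simps)
  then show "16 * (pi - 2 * pi / L)\<^sup>2 / (1 + 4 * (pi / L)\<^sup>2) \<le> L\<^sup>2 * (4 - hardy_const 2 a b)"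
    unfolding val using lower \<alpha> pos
    by (intro frac_le mult_left_mono power_mono add_left_mono) auto
  have "16 * (\<alpha> * L)\<^sup>2 / (1 + 4 * \<alpha>\<^sup>2) \<le> 16 * pi\<^sup>2 / 1"
    using upper \<alpha> L by (intro frac_le mult_left_mono power_mono) auto
  then show "L\<^sup>2 * (4 - hardy_const 2 a b) \<le> 16 * pi\<^sup>2" unfolding val by simp
qed

theorem corollary1p4:
  fixes p :: real
  assumes "2 \<le> p"
  shows "(\<exists>C1 C2 L0 :: real. C1 > 0 \<and> C2 > 0 \<and> L0 > 0
            \<and> C1 \<le> (p / (p - 1)) powr (p + 1) * p * pi\<^sup>2
            \<and> (\<forall>a b. 0 < a \<and> a < b \<and> L0 \<le> ln (b / a) \<longrightarrow>
                  (p / (p - 1)) powr p - C1 / (ln (b / a))\<^sup>2 \<le> hardy_const p a b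
                \<and> hardy_const p a b \<le> (p / (p - 1)) powr p - C2 / (ln (b / a))\<^sup>2))
       \<and> (p = 2 \<longrightarrow>
            ((\<lambda>(a, b). (ln (b / a))\<^sup>2 * (4 - hardy_const p a b)) \<longlongrightarrow> 16 * pi\<^sup>2)
              (inf (filtercomap (\<lambda>(a, b). ln (b / a)) at_top) (principal {(a, b). 0 < a \<and> a < b})))"
proof (intro conjI impI)
  let ?C1 = "(p / (p - 1)) powr (p + 1) * p * pi\<^sup>2" and ?C2 = "(p / (p - 1)) powr p / 24"
  show "\<exists>C1 C2 L0 :: real. C1 > 0 \<and> C2 > 0 \<and> L0 > 0
      \<and> C1 \<le> ?C1
      \<and> (\<forall>a b. 0 < a \<and> a < b \<and> L0 \<le> ln (b / a) \<longrightarrow>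
            (p / (p - 1)) powr p - C1 / (ln (b / a))\<^sup>2 \<le> hardy_const p a b
          \<and> hardy_const p a b \<le> (p / (p - 1)) powr p - C2 / (ln (b / a))\<^sup>2)"
    using assms hardy_const_ge[OF assms] hardy_const_le[OF assms]
    by (intro exI[of _ ?C1] exI[of _ ?C2] exI[of _ 1] conjI) auto
next
  assume p2: "p = 2"
  let ?F = "inf (filtercomap (\<lambda>(a, b). ln (b / a)) at_top)
      (principal {(a, b). 0 < a \<and> a < b}) :: (real \<times> real) filter"
  let ?low = "\<lambda>L :: real. 16 * (pi - 2 * pi / L)\<^sup>2 / (1 + 4 * (pi / L)\<^sup>2)"
  have lim: "filterlim (\<lambda>(a, b). ln (b / a)) at_top ?F"
    by (rule filterlim_mono[OF filterlim_filtercomap order_refl inf_le1])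
  have "(?low \<longlongrightarrow> 16 * (pi - 0)\<^sup>2 / (1 + 4 * 0\<^sup>2)) at_top"
    by (intro tendsto_intros tendsto_divide_0[OF tendsto_const] filterlim_at_top_imp_at_infinity filterlim_ident) auto
  then have "(?low \<longlongrightarrow> 16 * pi\<^sup>2) at_top" by simp
  from filterlim_compose[OF this lim] have low: "((\<lambda>(a, b). ?low (ln (b / a))) \<longlongrightarrow> 16 * pi\<^sup>2) ?F"
    by (rule back_subst[of "\<lambda>g. (g \<longlongrightarrow> 16 * pi\<^sup>2) ?F"]) auto
  have ev: "eventually (\<lambda>(a, b). 0 < a \<and> a < b \<and> 2 \<le> ln (b / a)) ?F"
  proof -
    have "eventually (\<lambda>z. 2 \<le> (case z of (a, b) \<Rightarrow> ln (b / a))) ?F"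
      using lim by (simp add: filterlim_at_top)
    moreover have "eventually (\<lambda>z. z \<in> {(a, b). 0 < a \<and> a < b}) ?F"
      by (simp add: eventually_inf_principal)
    ultimately show ?thesis by eventually_elim auto
  qed
  show "((\<lambda>(a, b). (ln (b / a))\<^sup>2 * (4 - hardy_const p a b)) \<longlongrightarrow> 16 * pi\<^sup>2) ?F"
    unfolding p2
  proof (rule tendsto_sandwich[OF _ _ low tendsto_const])
    show "eventually (\<lambda>z. (case z of (a, b) \<Rightarrow> ?low (ln (b / a)))
        \<le> (case z of (a, b) \<Rightarrow> (ln (b / a))\<^sup>2 * (4 - hardy_const 2 a b))) ?F"
      using ev by eventually_elim (auto intro: hardy_const_two_bounds(1))
    show "eventually (\<lambda>z. (case z of (a, b) \<Rightarrow> (ln (b / a))\<^sup>2 * (4 - hardy_const 2 a b)) \<le> 16 * pi\<^sup>2) ?F"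
      using ev by eventually_elim (auto intro: hardy_const_two_bounds(2))
  qed
qed

end
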